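(* Let $F(\bm{\lambda})=\sum_{i\in[I]}a_i\prod_{j\in[p]}\lambda_j^{n_{i,j}}$ with $a_i\in\mathbb{R}$ and nonnegative integers $n_{i,j}$, let $\bm{l},\bm{u}\in\mathbb{R}^p$ with $l_j<u_j$ for all $j$, let $K>\max\{F(\bm{\lambda}):\bm{l}\le\bm{\lambda}\le\bm{u}\}$, and $f(\bm{\theta})=-\ln\big(K-F(\mathrm{diag}(\bm{u}-\bm{l})\bm{\theta}+\bm{l})\big)$ on $[\bm{0},\bm{1}]\subset\mathbb{R}^p$. Let $m_j$ be positive integers with $m_j\ge\max\{n_{i,j}:i\in[I]\}$, $j\in[p]$. If the product of binomial distributions $$p_{\bm{x}}(\bm{\theta})=\prod_{j\in[p]}\frac{m_j!}{x_j!(m_j-x_j)!}\theta_j^{x_j}(1-\theta_j)^{m_j-x_j},\qquad \bm{x}\in\prod_{j\in[p]}\{0,1,\ldots,m_j\},$$ is employed in the EM algorithm for minimizing $f$ over $[\bm{0},\bm{1}]$, then the natural gradient update formula $\bm{\theta}^{(t)}=\bm{\theta}^{(t-1)}-\bm{I}_{p_{\bm{x}}}(\bm{\theta}^{(t-1)})^{-1}\nabla f(\bm{\theta}^{(t-1)})$ results in $$\theta_j^{(t)}=\theta_j^{(t-1)}-\frac{\theta_j^{(t-1)}(1-\theta_j^{(t-1)})}{m_j}\frac{\partial}{\partial\theta_j}f(\bm{\theta}^{(t-1)}),\qquad j\in[p].$$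
   Context: $[n]:=\{1,\ldots,n\}$; $\mathrm{diag}(\bm{v})$ is the diagonal matrix with diagonal $\bm{v}$; vector inequalities and intervals are componentwise. EM algorithm for minimizing $f$ over $\Theta$ (here $\Theta=[\bm{0},\bm{1}]$): given a parametric probability mass function $p_{\bm{x}}(\bm{\theta})$ and a positive function $G$ with $f(\bm{\theta})=-\ln\mathbb{E}_{p_{\bm{x}}(\bm{\theta})}[G(\bm{X})]$ on $\mathrm{int}\,\Theta$, start at $\bm{\theta}^{(0)}\in\mathrm{int}\,\Theta$ and iterate $\bm{\theta}^{(t)}\in\arg\min_{\bm{\theta}\in\Theta}\{-\sum_{\bm{x}}q_{\bm{x}}(\bm{\theta}^{(t-1)})\ln(G(\bm{x})p_{\bm{x}}(\bm{\theta}))\}$, where $q_{\bm{x}}(\bm{\theta})=G(\bm{x})p_{\bm{x}}(\bm{\theta})/\mathbb{E}_{p_{\bm{x}}(\bm{\theta})}[G(\bm{X})]$; the natural gradient update formula in the claim is the one giving the stationary point of this minimization. Fisher information matrix: $\bm{I}_{p_{\bm{x}}}(\bm{\theta}):=\mathbb{E}_{p_{\bm{x}}(\bm{\theta})}[\nabla\ln p_{\bm{X}}(\bm{\theta})\nabla\ln p_{\bm{X}}(\bm{\theta})^\top]$ (gradients in $\bm{\theta}$). *)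

theory Defs
  imports "HOL-Analysis.Analysis"
begin

definition grad :: "('a::real_inner \<Rightarrow> real) \<Rightarrow> 'a \<Rightarrow> 'a" where
  "grad f x = (THE D. GDERIV f x :> D)"

definition partial_deriv :: "'n \<Rightarrow> (real ^ 'n \<Rightarrow> real) \<Rightarrow> real ^ 'n \<Rightarrow> real" where
  "partial_deriv j f x = deriv (\<lambda>s. f (\<chi> k. if k = j then s else x $ k)) (x $ j)"

definition diag_matrix :: "real ^ 'n \<Rightarrow> real ^ 'n ^ 'n" where
  "diag_matrix v = (\<chi> i j. if i = j then v $ i else 0)"

definition outer_prod :: "real ^ 'n \<Rightarrow> real ^ 'n \<Rightarrow> real ^ 'n ^ 'n" where
  "outer_prod v w = (\<chi> i j. v $ i * w $ j)"

(* Below, a parametric probability mass function on a finite sample space S is a function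
   p of the sample point x and the parameter \<theta>. *)

definition expect :: "'x set \<Rightarrow> ('x \<Rightarrow> 'v \<Rightarrow> real) \<Rightarrow> 'v \<Rightarrow> ('x \<Rightarrow> 'b::real_vector) \<Rightarrow> 'b" where
  "expect S p \<theta> h = (\<Sum>x\<in>S. p x \<theta> *\<^sub>R h x)"

definition fisher_information ::
  "'x set \<Rightarrow> ('x \<Rightarrow> real ^ 'n \<Rightarrow> real) \<Rightarrow> real ^ 'n \<Rightarrow> real ^ 'n ^ 'n" where
  "fisher_information S p \<theta> =
     expect S p \<theta> (\<lambda>x. outer_prod (grad (\<lambda>\<eta>. ln (p x \<eta>)) \<theta>) (grad (\<lambda>\<eta>. ln (p x \<eta>)) \<theta>))"

definition natural_gradient_update ::
  "'x set \<Rightarrow> ('x \<Rightarrow> real ^ 'n \<Rightarrow> real) \<Rightarrow> (real ^ 'n \<Rightarrow> real) \<Rightarrow> real ^ 'n \<Rightarrow> real ^ 'n" where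
  "natural_gradient_update S p f \<theta> = \<theta> - matrix_inv (fisher_information S p \<theta>) *v grad f \<theta>"

definition em_weight ::
  "'x set \<Rightarrow> ('x \<Rightarrow> 'v \<Rightarrow> real) \<Rightarrow> ('x \<Rightarrow> real) \<Rightarrow> 'v \<Rightarrow> 'x \<Rightarrow> real" where
  "em_weight S p G \<theta> x = G x * p x \<theta> / expect S p \<theta> G"

(* The real-valued ln has ln 0 = 0. On the boundary of the parameter set the probabilities can
   vanish, so the EM objective needs the convention ln 0 = -\<infinity>. *)
definition ext_ln :: "real \<Rightarrow> ereal" where
  "ext_ln y = (if y > 0 then ereal (ln y) else - \<infinity>)"

definition em_objective ::
  "'x set \<Rightarrow> ('x \<Rightarrow> 'v \<Rightarrow> real) \<Rightarrow> ('x \<Rightarrow> real) \<Rightarrow> 'v \<Rightarrow> 'v \<Rightarrow> ereal" where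
  "em_objective S p G \<theta>\<^sub>0 \<theta> = - (\<Sum>x\<in>S. ereal (em_weight S p G \<theta>\<^sub>0 x) * ext_ln (G x * p x \<theta>))"

definition em_applicable ::
  "'x set \<Rightarrow> ('x \<Rightarrow> 'v \<Rightarrow> real) \<Rightarrow> ('x \<Rightarrow> real) \<Rightarrow> ('v::topological_space \<Rightarrow> real) \<Rightarrow> 'v set \<Rightarrow> bool" where
  "em_applicable S p G f \<Theta> \<longleftrightarrow>
     (\<forall>x\<in>S. G x > 0) \<and> (\<forall>\<theta>\<in>interior \<Theta>. f \<theta> = - ln (expect S p \<theta> G))"

definition em_iterates ::
  "'x set \<Rightarrow> ('x \<Rightarrow> 'v \<Rightarrow> real) \<Rightarrow> ('x \<Rightarrow> real) \<Rightarrow> 'v::topological_space set \<Rightarrow> (nat \<Rightarrow> 'v) \<Rightarrow> bool" where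
  "em_iterates S p G \<Theta> \<theta> \<longleftrightarrow>
     \<theta> 0 \<in> interior \<Theta> \<and>
     (\<forall>t\<ge>1. is_arg_min (em_objective S p G (\<theta> (t - 1))) (\<lambda>\<eta>. \<eta> \<in> \<Theta>) (\<theta> t))"

definition poly_fun ::
  "nat \<Rightarrow> (nat \<Rightarrow> real) \<Rightarrow> (nat \<Rightarrow> 'n::finite \<Rightarrow> nat) \<Rightarrow> real ^ 'n \<Rightarrow> real" where
  "poly_fun N a n y = (\<Sum>i=1..N. a i * (\<Prod>j\<in>UNIV. (y $ j) ^ n i j))"

definition log_objective ::
  "(real ^ 'n \<Rightarrow> real) \<Rightarrow> real \<Rightarrow> real ^ 'n \<Rightarrow> real ^ 'n \<Rightarrow> real ^ 'n \<Rightarrow> real" where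
  "log_objective F K l u \<theta> = - ln (K - F (diag_matrix (u - l) *v \<theta> + l))"

definition binomial_support :: "('n \<Rightarrow> nat) \<Rightarrow> ('n \<Rightarrow> nat) set" where
  "binomial_support m = (\<Pi>\<^sub>E j\<in>UNIV. {0..m j})"

definition binomial_product :: "('n::finite \<Rightarrow> nat) \<Rightarrow> ('n \<Rightarrow> nat) \<Rightarrow> real ^ 'n \<Rightarrow> real" where
  "binomial_product m x \<theta> =
     (\<Prod>j\<in>UNIV. fact (m j) / (fact (x j) * fact (m j - x j))
        * (\<theta> $ j) ^ x j * (1 - \<theta> $ j) ^ (m j - x j))"

end

theory Submission
  imports Defs
begin

text \<open>
  The score of the product of binomials has components
  \<open>(x\<^sub>j - m\<^sub>j \<theta>\<^sub>j) / (\<theta>\<^sub>j (1 - \<theta>\<^sub>j))\<close>, so by independence the Fisher information is diagonal,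
  with entries \<open>m\<^sub>j / (\<theta>\<^sub>j (1 - \<theta>\<^sub>j))\<close> given by the binomial variance. For the EM iteration, every
  sample point has positive weight, so the EM objective is infinite on the boundary of the unit cube
  and a minimizer is an interior stationary point; solving the stationarity equations gives
  \<open>\<eta>\<^sub>j = E\<^sub>w[x\<^sub>j] / m\<^sub>j\<close>. Since \<open>f = - ln E[G]\<close>, the gradient of \<open>f\<close> is minus the \<open>w\<close>-expectation of
  the score, and the natural gradient step lands on the same point.
\<close>

section \<open>Gradients and their relation to partial derivatives\<close>

lemma GDERIV_unique:
  assumes "GDERIV f x :> D" "GDERIV f x :> E"
  shows "D = E"
proof -
  have "(\<lambda>h. inner h D) = (\<lambda>h. inner h E)"
    using assms unfolding gderiv_def by (rule has_derivative_unique)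
  then show ?thesis
    by (metis vector_eq_ldot)
qed

text \<open>Uniqueness of gradients determines the definite description in
  \<open>grad\<close>.\<close>

lemma grad_eqI: "GDERIV f x :> D \<Longrightarrow> grad f x = D"
  unfolding grad_def by (blast intro: the_equality GDERIV_unique)

lemma GDERIV_sum:
  assumes "\<And>i. i \<in> I \<Longrightarrow> GDERIV (f i) x :> D i"
  shows "GDERIV (\<lambda>y. \<Sum>i\<in>I. f i y) x :> (\<Sum>i\<in>I. D i)"
  using assms unfolding gderiv_def inner_sum_right by (rule has_derivative_sum)

lemma GDERIV_transform_within_open:
  assumes "GDERIV f x :> D" "open S" "x \<in> S" "\<And>y. y \<in> S \<Longrightarrow> f y = g y"
  shows "GDERIV g x :> D"
  using assms unfolding gderiv_def by (rule has_derivative_transform_within_open)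

text \<open>Riesz representation: a linear functional is the inner product with the image of 1 under
  its adjoint.\<close>

lemma differentiable_imp_GDERIV:
  fixes f :: "'a::euclidean_space \<Rightarrow> real"
  assumes "f differentiable (at x)"
  obtains D where "GDERIV f x :> D"
proof -
  obtain f' where f': "(f has_derivative f') (at x)"
    using assms unfolding differentiable_def by blast
  have "f' = (\<lambda>h. inner h (adjoint f' 1))"
    using adjoint_works[OF has_derivative_linear[OF f'], of _ 1] by (simp add: fun_eq_iff)
  with f' have "GDERIV f x :> adjoint f' 1"
    unfolding gderiv_def by metis
  then show thesis ..
qed

lemma partial_deriv_eq_GDERIV:
  fixes f :: "real ^ 'n \<Rightarrow> real"
  assumes "GDERIV f x :> D"
  shows "partial_deriv j f x = D $ j"
proof -
  \<comment> \<open>The coordinate line through \<open>x\<close>, written as an affine curve so that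
    the derivative rules apply; composing \<open>f\<close> with it gives the function differentiated
    in \<open>partial_deriv\<close>.\<close>
  define c where "c = (\<lambda>s. x + (s - x $ j) *\<^sub>R axis j (1::real))"
  have c: "c = (\<lambda>s. \<chi> k. if k = j then s else x $ k)"
    by (auto simp: c_def fun_eq_iff vec_eq_iff axis_def)
  have "(c has_derivative (\<lambda>s. s *\<^sub>R axis j 1)) (at (x $ j))"
    unfolding c_def by (auto intro!: derivative_eq_intros)
  moreover have "(f has_derivative (\<lambda>h. inner h D)) (at (c (x $ j)))"
    using assms by (simp add: c_def gderiv_def)
  ultimately have "((\<lambda>s. f (c s)) has_derivative (\<lambda>s. inner (s *\<^sub>R axis j 1) D)) (at (x $ j))"
    by (rule has_derivative_compose)
  then have "((\<lambda>s. f (c s)) has_real_derivative D $ j) (at (x $ j))"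
    by (simp add: has_field_derivative_def inner_axis' mult_commute_abs)
  then show ?thesis
    unfolding partial_deriv_def c by (rule DERIV_imp_deriv)
qed

section \<open>Diagonal matrices and inverses\<close>

lemma diag_matrix_mult_vec_component [simp]: "(diag_matrix v *v w) $ j = v $ j * w $ j"
proof -
  have "(diag_matrix v *v w) $ j = (\<Sum>k\<in>UNIV. if k = j then v $ j * w $ j else 0)"
    unfolding matrix_vector_mult_def diag_matrix_def vec_lambda_beta
    by (rule sum.cong) auto
  then show ?thesis by simp
qed

lemma diag_matrix_inverse:
  assumes "\<And>j. v $ j * w $ j = 1"
  shows "diag_matrix v ** diag_matrix w = mat 1"
  using assms by (simp add: matrix_eq vec_eq_iff flip: matrix_vector_mul_assoc mult.assoc)

text \<open>For square matrices a right inverse already gives invertibility, so the choice behind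
  \<open>matrix_inv\<close> yields a genuine left inverse; associativity then identifies the
  two.\<close>

lemma matrix_inv_eqI:
  fixes A B :: "real ^ 'n ^ 'n"
  assumes "A ** B = mat 1"
  shows "matrix_inv A = B"
proof -
  have "invertible A"
    using assms invertible_right_inverse by blast
  then have left: "matrix_inv A ** A = mat 1"
    unfolding invertible_def matrix_inv_def by (rule someI2_ex) blast
  have "matrix_inv A = matrix_inv A ** (A ** B)"
    by (simp add: assms)
  also have "\<dots> = B"
    by (simp add: matrix_mul_assoc left)
  finally show ?thesis .
qed

section \<open>Mean and variance of the binomial distribution, via Bernstein polynomials\<close>

lemma Bernstein_central_moment_1: "(\<Sum>k\<le>n. Bernstein n k x * (real k - real n * x)) = 0"
proof -
  have "(\<Sum>k\<le>n. Bernstein n k x * (real k - real n * x))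
      = (\<Sum>k\<le>n. real k * Bernstein n k x) - real n * x * (\<Sum>k\<le>n. Bernstein n k x)"
    by (simp only: sum_distrib_left flip: sum_subtractf) (simp add: algebra_simps)
  then show ?thesis by simp
qed

lemma Bernstein_central_moment_2:
  "(\<Sum>k\<le>n. Bernstein n k x * (real k - real n * x)\<^sup>2) = real n * x * (1 - x)"
proof -
  \<comment> \<open>With \<mu> = n x, expand (k - \<mu>)^2 = k (k - 1) + (1 - 2 \<mu>) k + \<mu>^2.
    The three sums are the known moments n (n - 1) x^2, n x and 1.\<close>
  have "(\<Sum>k\<le>n. Bernstein n k x * (real k - real n * x)\<^sup>2)
      = (\<Sum>k\<le>n. real k * (real k - 1) * Bernstein n k x)
        + (1 - 2 * real n * x) * (\<Sum>k\<le>n. real k * Bernstein n k x)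
        + (real n * x)\<^sup>2 * (\<Sum>k\<le>n. Bernstein n k x)"
    by (simp only: sum_distrib_left flip: sum.distrib)
       (simp add: algebra_simps power2_eq_square)
  also have "\<dots> = real n * x * (1 - x)"
    by (simp only: sum_kk_Bernstein sum_k_Bernstein sum_Bernstein)
       (simp add: algebra_simps power2_eq_square)
  finally show ?thesis .
qed

section \<open>The product of binomials: positivity, independence, covariance\<close>

lemma finite_binomial_support: "finite (binomial_support (m :: 'n::finite \<Rightarrow> nat))"
  unfolding binomial_support_def by (intro finite_PiE) auto

lemma binomial_support_le: "x \<in> binomial_support m \<Longrightarrow> x j \<le> m j"
  unfolding binomial_support_def by (metis PiE_mem UNIV_I atLeastAtMost_iff)

lemma binomial_product_eq_Bernstein:
  assumes "x \<in> binomial_support m"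
  shows "binomial_product m x \<theta> = (\<Prod>j\<in>UNIV. Bernstein (m j) (x j) (\<theta> $ j))"
  unfolding binomial_product_def Bernstein_def
  using binomial_support_le[OF assms] by (intro prod.cong) (simp_all add: binomial_fact)

lemma binomial_product_pos:
  assumes "\<theta> \<in> box 0 1" "x \<in> binomial_support m"
  shows "binomial_product m x \<theta> > 0"
  unfolding binomial_product_eq_Bernstein[OF assms(2)]
  using assms(1) binomial_support_le[OF assms(2)]
  by (intro prod_pos ballI Bernstein_pos) (auto simp: mem_box_cart)

lemma expect_binomial_product_pos:
  assumes "\<theta> \<in> box 0 1" "\<And>x. x \<in> binomial_support m \<Longrightarrow> (G x :: real) > 0"
  shows "expect (binomial_support m) (binomial_product m) \<theta> G > 0"
proof -
  have "binomial_support m \<noteq> {}"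
    by (auto simp: binomial_support_def PiE_eq_empty_iff)
  then show ?thesis
    unfolding expect_def real_scaleR_def
    by (intro sum_pos mult_pos_pos finite_binomial_support binomial_product_pos assms)
qed

text \<open>Independence of the coordinates: since the support is a full product of ranges, the sum
  of products over it factors into a product of one-dimensional sums.\<close>

lemma expect_binomial_product_prod:
  fixes g :: "'n::finite \<Rightarrow> nat \<Rightarrow> real"
  shows "expect (binomial_support m) (binomial_product m) \<theta> (\<lambda>x. \<Prod>j\<in>UNIV. g j (x j))
    = (\<Prod>j\<in>UNIV. \<Sum>k\<le>m j. Bernstein (m j) k (\<theta> $ j) * g j k)"
proof -
  have "expect (binomial_support m) (binomial_product m) \<theta> (\<lambda>x. \<Prod>j\<in>UNIV. g j (x j))
      = (\<Sum>x\<in>binomial_support m. \<Prod>j\<in>UNIV. Bernstein (m j) (x j) (\<theta> $ j) * g j (x j))"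
    unfolding expect_def
    by (rule sum.cong) (simp_all add: binomial_product_eq_Bernstein prod.distrib)
  also have "\<dots> = (\<Prod>j\<in>UNIV. \<Sum>k\<le>m j. Bernstein (m j) k (\<theta> $ j) * g j k)"
    unfolding binomial_support_def atLeast0AtMost by (rule prod_sum_PiE[symmetric]) auto
  finally show ?thesis .
qed

lemma binomial_product_covariance:
  "expect (binomial_support m) (binomial_product m) \<theta>
     (\<lambda>x. (real (x i) - real (m i) * \<theta> $ i) * (real (x j) - real (m j) * \<theta> $ j))
   = (if i = j then real (m i) * \<theta> $ i * (1 - \<theta> $ i) else 0)"
proof -
  define c where "c k y = real y - real (m k) * \<theta> $ k" for k y
  \<comment> \<open>This writes the product of two centred counts as a product over all coordinates,
    with factor 1 away from \<open>i\<close> and \<open>j\<close>; if \<open>i = j\<close>, both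
    factors meet in one coordinate and form the square.\<close>
  define g where "g k y = (if k = i then c k y else 1) * (if k = j then c k y else 1)" for k y
  have "c i (x i) * c j (x j) = (\<Prod>k\<in>UNIV. g k (x k))" for x
    by (simp add: g_def prod.distrib)
  then have "expect (binomial_support m) (binomial_product m) \<theta> (\<lambda>x. c i (x i) * c j (x j))
      = (\<Prod>k\<in>UNIV. \<Sum>y\<le>m k. Bernstein (m k) y (\<theta> $ k) * g k y)"
    by (simp only: expect_binomial_product_prod)
  also have "\<dots> = (if i = j then real (m i) * \<theta> $ i * (1 - \<theta> $ i) else 0)"
  proof (cases "i = j")
    case True
    \<comment> \<open>Coordinate \<open>i\<close> contributes the variance, every other one the
      total mass 1.\<close>
    then have "(\<Sum>y\<le>m k. Bernstein (m k) y (\<theta> $ k) * g k y)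
        = (if k = i then real (m k) * \<theta> $ k * (1 - \<theta> $ k) else 1)" for k
      using Bernstein_central_moment_2
      by (simp add: g_def c_def flip: power2_eq_square)
    then show ?thesis using True by simp
  next
    case False
    \<comment> \<open>Here coordinate \<open>i\<close> carries a single centred factor, whose mean
      is zero, and this annihilates the whole product.\<close>
    then have "(\<Sum>y\<le>m i. Bernstein (m i) y (\<theta> $ i) * g i y) = 0"
      using Bernstein_central_moment_1 by (simp add: g_def c_def)
    then have "(\<Prod>k\<in>UNIV. \<Sum>y\<le>m k. Bernstein (m k) y (\<theta> $ k) * g k y) = 0"
      by (intro prod_zero) auto
    then show ?thesis using False by simp
  qed
  finally show ?thesis by (simp add: c_def)
qed

section \<open>Score, Fisher information and the natural gradient step\<close>

definition binomial_score :: "('n::finite \<Rightarrow> nat) \<Rightarrow> ('n \<Rightarrow> nat) \<Rightarrow> real ^ 'n \<Rightarrow> real ^ 'n" where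
  "binomial_score m x \<theta> = (\<chi> j. (real (x j) - real (m j) * \<theta> $ j) / (\<theta> $ j * (1 - \<theta> $ j)))"

text \<open>The logarithm splits the product into a sum of functions of one coordinate each. This
  splitting is used on the open box, where all factors are positive, and a neighbourhood suffices
  for the derivative.\<close>

lemma GDERIV_ln_binomial_product:
  assumes \<theta>: "\<theta> \<in> box 0 1" and x: "x \<in> binomial_support m"
  shows "GDERIV (\<lambda>\<eta>. ln (binomial_product m x \<eta>)) \<theta> :> binomial_score m x \<theta>"
proof (rule GDERIV_transform_within_open)
  define \<phi> where "\<phi> j s = ln (real (m j choose x j)) + real (x j) * ln s
      + real (m j - x j) * ln (1 - s)" for j s
  show "GDERIV (\<lambda>\<eta>. \<Sum>j\<in>UNIV. \<phi> j (\<eta> $ j)) \<theta> :> binomial_score m x \<theta>"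
    unfolding gderiv_def
  proof (rule has_derivative_eq_rhs[OF has_derivative_sum])
    fix j
    have \<theta>j: "0 < \<theta> $ j" "\<theta> $ j < 1"
      using \<theta> by (auto simp: mem_box_cart)
    have "(\<phi> j has_real_derivative
        real (x j) / \<theta> $ j - real (m j - x j) / (1 - \<theta> $ j)) (at (\<theta> $ j))"
      unfolding \<phi>_def using \<theta>j by (auto intro!: derivative_eq_intros)
    \<comment> \<open>Over the common denominator the numerator is x (1 - \<theta>) - (m - x)
      \<theta> = x - m \<theta>; \<open>x j \<le> m j\<close> makes the natural-number subtraction
      agree with the real one.\<close>
    also have "real (x j) / \<theta> $ j - real (m j - x j) / (1 - \<theta> $ j) = binomial_score m x \<theta> $ j"
      using \<theta>j binomial_support_le[OF x, of j]
      by (simp add: binomial_score_def diff_frac_eq of_nat_diff) (simp add: algebra_simps)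
    finally have "(\<phi> j has_real_derivative binomial_score m x \<theta> $ j) (at (\<theta> $ j))" .
    moreover have "((\<lambda>\<eta>. \<eta> $ j) has_derivative (\<lambda>h. h $ j)) (at \<theta>)"
      by (intro bounded_linear_imp_has_derivative bounded_linear_vec_nth)
    ultimately show "((\<lambda>\<eta>. \<phi> j (\<eta> $ j)) has_derivative (\<lambda>h. binomial_score m x \<theta> $ j * h $ j)) (at \<theta>)"
      unfolding has_field_derivative_def by (rule has_derivative_compose[rotated])
  qed (simp add: inner_vec_def mult.commute)
  show "(\<Sum>j\<in>UNIV. \<phi> j (\<eta> $ j)) = ln (binomial_product m x \<eta>)"
    if "\<eta> \<in> box 0 1" for \<eta>
  proof -
    have \<eta>: "0 < \<eta> $ j" "\<eta> $ j < 1" for j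
      using that by (auto simp: mem_box_cart)
    then have "ln (binomial_product m x \<eta>) = (\<Sum>j\<in>UNIV. ln (Bernstein (m j) (x j) (\<eta> $ j)))"
      unfolding binomial_product_eq_Bernstein[OF x]
      using \<eta> binomial_support_le[OF x]
      by (intro ln_prod) (auto intro!: Bernstein_pos less_imp_neq[symmetric])
    also have "\<dots> = (\<Sum>j\<in>UNIV. \<phi> j (\<eta> $ j))"
    proof (rule sum.cong)
      fix j
      show "ln (Bernstein (m j) (x j) (\<eta> $ j)) = \<phi> j (\<eta> $ j)"
        using \<eta>[of j] binomial_support_le[OF x, of j]
        by (simp add: \<phi>_def Bernstein_def ln_mult ln_realpow)
    qed simp
    finally show ?thesis by simp
  qed
qed (use \<theta> in auto)

text \<open>Logarithmic differentiation: near \<theta> the probability equals \<open>exp\<close> of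
  its own logarithm.\<close>

lemma GDERIV_binomial_product:
  assumes \<theta>: "\<theta> \<in> box 0 1" and x: "x \<in> binomial_support m"
  shows "GDERIV (binomial_product m x) \<theta> :> binomial_product m x \<theta> *\<^sub>R binomial_score m x \<theta>"
proof (rule GDERIV_transform_within_open)
  have "GDERIV (\<lambda>\<eta>. exp (ln (binomial_product m x \<eta>))) \<theta>
      :> exp (ln (binomial_product m x \<theta>)) *\<^sub>R binomial_score m x \<theta>"
    by (intro GDERIV_DERIV_compose GDERIV_ln_binomial_product \<theta> x DERIV_exp)
  then show "GDERIV (\<lambda>\<eta>. exp (ln (binomial_product m x \<eta>))) \<theta>
      :> binomial_product m x \<theta> *\<^sub>R binomial_score m x \<theta>"
    by (simp add: binomial_product_pos \<theta> x)
qed (use \<theta> x binomial_product_pos in auto)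

lemma fisher_information_binomial_product:
  assumes \<theta>: "\<theta> \<in> box 0 1"
  shows "fisher_information (binomial_support m) (binomial_product m) \<theta>
    = diag_matrix (\<chi> j. real (m j) / (\<theta> $ j * (1 - \<theta> $ j)))"
proof -
  let ?S = "binomial_support m" and ?p = "binomial_product m"
  have \<theta>j: "\<theta> $ j \<noteq> 0" "1 - \<theta> $ j \<noteq> 0" for j
    using \<theta> by (auto simp: mem_box_cart less_le)
  have "fisher_information ?S ?p \<theta>
      = expect ?S ?p \<theta> (\<lambda>x. outer_prod (binomial_score m x \<theta>) (binomial_score m x \<theta>))"
    unfolding fisher_information_def expect_def
    by (rule sum.cong) (simp_all add: grad_eqI[OF GDERIV_ln_binomial_product[OF \<theta>]])
  also have "\<dots> = diag_matrix (\<chi> j. real (m j) / (\<theta> $ j * (1 - \<theta> $ j)))"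
  proof (simp only: vec_eq_iff, intro allI)
    fix i j
    \<comment> \<open>The denominators of the score do not depend on the sample point, so they leave
      the expectation and what remains is the covariance of the counts.\<close>
    have "expect ?S ?p \<theta> (\<lambda>x. outer_prod (binomial_score m x \<theta>) (binomial_score m x \<theta>)) $ i $ j
      = expect ?S ?p \<theta>
          (\<lambda>x. (real (x i) - real (m i) * \<theta> $ i) * (real (x j) - real (m j) * \<theta> $ j))
        / ((\<theta> $ i * (1 - \<theta> $ i)) * (\<theta> $ j * (1 - \<theta> $ j)))"
      by (simp add: expect_def outer_prod_def binomial_score_def sum_divide_distrib)
    then show "expect ?S ?p \<theta> (\<lambda>x. outer_prod (binomial_score m x \<theta>) (binomial_score m x \<theta>)) $ i $ j
      = diag_matrix (\<chi> j. real (m j) / (\<theta> $ j * (1 - \<theta> $ j))) $ i $ j"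
      using \<theta>j by (simp add: binomial_product_covariance diag_matrix_def)
  qed
  finally show ?thesis .
qed

text \<open>The inverse is the diagonal of reciprocals, where \<open>m j > 0\<close> keeps the
  entries nonzero. Invertibility is recorded because \<open>matrix_inv\<close> is an arbitrary
  choice on singular matrices.\<close>

lemma
  assumes \<theta>: "\<theta> \<in> box 0 1" and m: "\<And>j. m j > 0"
  shows invertible_fisher_information_binomial_product:
      "invertible (fisher_information (binomial_support m) (binomial_product m) \<theta>)"
    and natural_gradient_update_binomial_product:
      "natural_gradient_update (binomial_support m) (binomial_product m) f \<theta> $ j
        = \<theta> $ j - \<theta> $ j * (1 - \<theta> $ j) / real (m j) * grad f \<theta> $ j"
proof -
  have "diag_matrix (\<chi> j. real (m j) / (\<theta> $ j * (1 - \<theta> $ j)))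
      ** diag_matrix (\<chi> j. \<theta> $ j * (1 - \<theta> $ j) / real (m j)) = mat 1"
  proof (rule diag_matrix_inverse)
    fix j
    have "0 < \<theta> $ j" "\<theta> $ j < 1"
      using \<theta> by (auto simp: mem_box_cart)
    then show "(\<chi> j. real (m j) / (\<theta> $ j * (1 - \<theta> $ j))) $ j
        * (\<chi> j. \<theta> $ j * (1 - \<theta> $ j) / real (m j)) $ j = 1"
      using m[of j] by simp
  qed
  then have inv: "fisher_information (binomial_support m) (binomial_product m) \<theta>
      ** diag_matrix (\<chi> j. \<theta> $ j * (1 - \<theta> $ j) / real (m j)) = mat 1"
    by (simp add: fisher_information_binomial_product[OF \<theta>])
  then show "invertible (fisher_information (binomial_support m) (binomial_product m) \<theta>)"
    using invertible_right_inverse by blast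
  show "natural_gradient_update (binomial_support m) (binomial_product m) f \<theta> $ j
      = \<theta> $ j - \<theta> $ j * (1 - \<theta> $ j) / real (m j) * grad f \<theta> $ j"
    by (simp add: natural_gradient_update_def matrix_inv_eqI[OF inv])
qed

section \<open>Differentiability of the log objective on the unit cube\<close>

lemma poly_fun_differentiable: "poly_fun N a n differentiable (at y)"
proof -
  have "((\<lambda>z. z $ j) has_derivative (\<lambda>h. h $ j)) (at y)" for j
    by (intro bounded_linear_imp_has_derivative bounded_linear_vec_nth)
  then have "\<exists>D. ((\<lambda>z. \<Prod>j\<in>UNIV. (z $ j) ^ n i j) has_derivative D) (at y)" for i
    by (intro exI, rule has_derivative_prod[OF has_derivative_power])
  then have "(\<lambda>z. a i * (\<Prod>j\<in>UNIV. (z $ j) ^ n i j)) differentiable (at y)" for i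
    by (intro differentiable_mult) (auto simp: differentiable_def)
  then show ?thesis
    unfolding poly_fun_def[abs_def] by (intro differentiable_sum) auto
qed

lemma log_objective_differentiable:
  fixes F :: "real ^ 'n \<Rightarrow> real"
  assumes "\<And>y. F differentiable (at y)" "F (diag_matrix (u - l) *v \<theta> + l) < K"
  shows "log_objective F K l u differentiable (at \<theta>)"
proof -
  obtain F' where F': "(F has_derivative F') (at (diag_matrix (u - l) *v \<theta> + l))"
    using assms(1) unfolding differentiable_def by blast
  have "((\<lambda>\<eta>. diag_matrix (u - l) *v \<eta>) has_derivative (\<lambda>h. diag_matrix (u - l) *v h)) (at \<theta>)"
    by (intro bounded_linear_imp_has_derivative matrix_vector_mul_bounded_linear)
  then have A: "((\<lambda>\<eta>. diag_matrix (u - l) *v \<eta> + l) has_derivative (\<lambda>h. diag_matrix (u - l) *v h)) (at \<theta>)"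
    by (auto intro!: derivative_eq_intros)
  \<comment> \<open>The bound by \<open>K\<close> makes the argument of \<open>ln\<close> positive,
    as the logarithm rule requires; the 0 is the derivative of the constant
    \<open>K\<close>.\<close>
  have "((\<lambda>\<eta>. - ln (K - F (diag_matrix (u - l) *v \<eta> + l))) has_derivative
      (\<lambda>h. - ((0 - F' (diag_matrix (u - l) *v h)) * inverse (K - F (diag_matrix (u - l) *v \<theta> + l))))) (at \<theta>)"
    using assms(2)
    by (intro derivative_intros has_derivative_compose[OF A F']) auto
  then show ?thesis
    unfolding log_objective_def[abs_def] differentiable_def by blast
qed

text \<open>A real \<open>SUP\<close> bounds its family only when the family is bounded above;
  compactness of the box supplies this.\<close>

lemma cbox_less_of_SUP_less:
  fixes F :: "'a::euclidean_space \<Rightarrow> real"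
  assumes "continuous_on (cbox l u) F" "(SUP y\<in>cbox l u. F y) < K" "y \<in> cbox l u"
  shows "F y < K"
proof -
  have "bdd_above (F ` cbox l u)"
    by (intro bounded_imp_bdd_above compact_imp_bounded compact_continuous_image assms(1) compact_cbox)
  then show ?thesis
    using assms(2,3) cSUP_upper le_less_trans by metis
qed

lemma affine_unit_cbox:
  fixes l u \<theta> :: "real ^ 'n"
  assumes "\<And>j. l $ j \<le> u $ j" "\<theta> \<in> cbox 0 1"
  shows "diag_matrix (u - l) *v \<theta> + l \<in> cbox l u"
  unfolding mem_box_cart
proof (intro allI conjI)
  fix j
  have \<theta>: "0 \<le> \<theta> $ j" "\<theta> $ j \<le> 1" and lu: "0 \<le> u $ j - l $ j"
    using assms by (auto simp: mem_box_cart)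
  show "l $ j \<le> (diag_matrix (u - l) *v \<theta> + l) $ j"
    using \<theta> lu by simp
  show "(diag_matrix (u - l) *v \<theta> + l) $ j \<le> u $ j"
    using mult_left_mono[OF \<theta>(2) lu] by simp
qed

section \<open>The EM objective, its minimizer and the gradient of f\<close>

lemma em_weight_binomial_pos:
  assumes "\<theta> \<in> box 0 1" "\<And>x. x \<in> binomial_support m \<Longrightarrow> G x > 0"
    and "x \<in> binomial_support m"
  shows "em_weight (binomial_support m) (binomial_product m) G \<theta> x > 0"
  using assms by (simp add: em_weight_def binomial_product_pos expect_binomial_product_pos)

lemma sum_em_weight:
  assumes "expect S p \<theta> G \<noteq> 0"
  shows "(\<Sum>x\<in>S. em_weight S p G \<theta> x) = 1"
  using assms by (simp add: em_weight_def expect_def mult.commute flip: sum_divide_distrib)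

text \<open>Inside the cube all logarithms are finite, so the extended objective becomes a real
  function open to calculus.\<close>

lemma em_objective_interior:
  assumes "\<eta> \<in> box 0 1" "\<And>x. x \<in> binomial_support m \<Longrightarrow> G x > 0"
  shows "em_objective (binomial_support m) (binomial_product m) G \<theta> \<eta>
    = ereal (- (\<Sum>x\<in>binomial_support m. em_weight (binomial_support m) (binomial_product m) G \<theta> x
        * (ln (G x) + ln (binomial_product m x \<eta>))))"
proof -
  let ?w = "em_weight (binomial_support m) (binomial_product m) G \<theta>"
  have "(\<Sum>x\<in>binomial_support m. ereal (?w x) * ext_ln (G x * binomial_product m x \<eta>))
      = (\<Sum>x\<in>binomial_support m. ereal (?w x * (ln (G x) + ln (binomial_product m x \<eta>))))"
  proof (rule sum.cong)
    fix x assume "x \<in> binomial_support m"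
    then have "G x > 0" "binomial_product m x \<eta> > 0"
      using assms binomial_product_pos by auto
    then show "ereal (?w x) * ext_ln (G x * binomial_product m x \<eta>)
        = ereal (?w x * (ln (G x) + ln (binomial_product m x \<eta>)))"
      by (simp add: ext_ln_def ln_mult)
  qed simp
  then show ?thesis by (simp add: em_objective_def)
qed

text \<open>In \<open>ereal\<close>, \<infinity> + (-\<infinity>) equals \<infinity>, so a term
  -\<infinity> decides the sum only if no other term is \<infinity>. That is excluded because
  \<open>ext_ln\<close> never equals \<infinity> and the weights are positive.\<close>

lemma em_objective_eq_PInfty:
  assumes "finite S" "\<And>x. x \<in> S \<Longrightarrow> em_weight S p G \<theta> x > 0" "y \<in> S" "p y \<eta> = 0"
  shows "em_objective S p G \<theta> \<eta> = \<infinity>"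
proof -
  let ?g = "\<lambda>x. ereal (em_weight S p G \<theta> x) * ext_ln (G x * p x \<eta>)"
  have "?g x \<noteq> \<infinity>" if "x \<in> S" for x
    using assms(2)[OF that] by (auto simp: ext_ln_def)
  then have "sum ?g (S - {y}) \<noteq> \<infinity>"
    by (auto simp: sum_Pinfty)
  moreover have "?g y = - \<infinity>"
    using assms(2)[OF assms(3)] assms(4) by (simp add: ext_ln_def)
  moreover have "sum ?g S = ?g y + sum ?g (S - {y})"
    using assms(1,3) by (rule sum.remove)
  ultimately have "sum ?g S = - \<infinity>"
    by (simp only: ereal_plus_eq_MInfty) simp
  then show ?thesis by (simp add: em_objective_def)
qed

lemma binomial_product_vanishes_on_boundary:
  assumes "\<eta> \<in> cbox 0 1" "\<eta> \<notin> box 0 1" "\<And>j. m j > 0"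
  obtains x where "x \<in> binomial_support m" "binomial_product m x \<eta> = 0"
proof -
  obtain j where j: "\<eta> $ j = 0 \<or> \<eta> $ j = 1"
    using assms(1,2) unfolding mem_box_cart by (force simp: less_le)
  \<comment> \<open>All successes have probability 0 when the success parameter is 0, and no
    successes when it is 1; both need a positive number of trials.\<close>
  define x where "x = (if \<eta> $ j = 0 then m else (\<lambda>_. 0))"
  have x: "x \<in> binomial_support m"
    by (auto simp: x_def binomial_support_def)
  have "Bernstein (m j) (x j) (\<eta> $ j) = 0"
    using j assms(3)[of j] by (auto simp: Bernstein_def x_def)
  then have "binomial_product m x \<eta> = 0"
    unfolding binomial_product_eq_Bernstein[OF x] by (intro prod_zero) auto
  with x show thesis ..
qed

text \<open>Both facts share one proof: the first-order condition that yields the closed form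
  becomes available once the minimizer is known to be interior.\<close>

lemma
  assumes \<theta>: "\<theta> \<in> box 0 1" and m: "\<And>j. m j > 0"
    and G: "\<And>x. x \<in> binomial_support m \<Longrightarrow> G x > 0"
    and min: "is_arg_min (em_objective (binomial_support m) (binomial_product m) G \<theta>)
      (\<lambda>\<eta>. \<eta> \<in> cbox 0 1) \<eta>"
  shows em_minimizer_binomial_interior: "\<eta> \<in> box 0 1"
    and em_minimizer_binomial_eq: "\<eta> $ j = (\<Sum>x\<in>binomial_support m.
      em_weight (binomial_support m) (binomial_product m) G \<theta> x * real (x j)) / real (m j)"
proof -
  let ?S = "binomial_support m" and ?p = "binomial_product m"
  let ?w = "em_weight ?S ?p G \<theta>" and ?Q = "em_objective ?S ?p G \<theta>"
  have le: "?Q \<eta> \<le> ?Q \<zeta>" if "\<zeta> \<in> cbox 0 1" for \<zeta>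
    using min that by (auto simp: is_arg_min_linorder)
  show int: "\<eta> \<in> box 0 1"
  proof (rule ccontr)
    assume "\<eta> \<notin> box 0 1"
    then obtain y where "y \<in> ?S" "?p y \<eta> = 0"
      using binomial_product_vanishes_on_boundary min m by (metis is_arg_min_def)
    then have "?Q \<eta> = \<infinity>"
      using em_weight_binomial_pos[OF \<theta> G]
      by (intro em_objective_eq_PInfty finite_binomial_support)
    \<comment> \<open>The current point \<theta> is a competitor with finite objective.\<close>
    moreover have "?Q \<eta> \<le> ?Q \<theta>"
      using le \<theta> box_subset_cbox by blast
    ultimately show False
      by (simp add: em_objective_interior[OF \<theta> G])
  qed
  \<comment> \<open>The negated objective as a real function on the open box, where \<eta> maximizes
    it; \<open>D\<close> will be its gradient at \<eta>.\<close>
  define R where "R \<zeta> = (\<Sum>x\<in>?S. ?w x * (ln (G x) + ln (?p x \<zeta>)))" for \<zeta>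
  define D where "D = (\<Sum>x\<in>?S. ?w x *\<^sub>R binomial_score m x \<eta>)"
  have "GDERIV (\<lambda>\<zeta>. ?w x * (ln (G x) + ln (?p x \<zeta>))) \<eta> :> ?w x *\<^sub>R binomial_score m x \<eta>"
    if "x \<in> ?S" for x
    using GDERIV_mult[OF GDERIV_const GDERIV_add[OF GDERIV_const GDERIV_ln_binomial_product[OF int that]]]
    by simp
  then have "GDERIV R \<eta> :> D"
    unfolding R_def D_def by (rule GDERIV_sum)
  moreover have "R \<zeta> \<le> R \<eta>" if "\<zeta> \<in> box 0 1" for \<zeta>
    using le[of \<zeta>] that box_subset_cbox
    by (auto simp: R_def em_objective_interior[OF int G] em_objective_interior[OF that G])
  ultimately have "(\<lambda>h. inner h D) = (\<lambda>h. 0)"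
    using int unfolding gderiv_def by (intro differential_zero_maxmin[of \<eta> "box 0 1"]) auto
  then have "D = 0"
    by (metis inner_eq_zero_iff)
  have \<eta>j: "\<eta> $ j \<noteq> 0" "1 - \<eta> $ j \<noteq> 0"
    using int by (auto simp: mem_box_cart less_le)
  \<comment> \<open>Clearing the denominators of the score makes the stationarity equation linear in
    \<open>\<eta> $ j\<close>.\<close>
  have "(\<Sum>x\<in>?S. ?w x * (real (x j) - real (m j) * \<eta> $ j)) = D $ j * (\<eta> $ j * (1 - \<eta> $ j))"
    using \<eta>j by (simp add: D_def binomial_score_def sum_distrib_right)
  also have "\<dots> = 0"
    using \<open>D = 0\<close> by simp
  finally have "(\<Sum>x\<in>?S. ?w x * real (x j)) = (\<Sum>x\<in>?S. ?w x) * (real (m j) * \<eta> $ j)"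
    by (simp add: right_diff_distrib sum_subtractf sum_distrib_right)
  also have "(\<Sum>x\<in>?S. ?w x) = 1"
    using expect_binomial_product_pos[OF \<theta> G] by (intro sum_em_weight) (auto simp: less_le)
  finally show "\<eta> $ j = (\<Sum>x\<in>?S. ?w x * real (x j)) / real (m j)"
    using m[of j] by simp
qed

text \<open>Differentiating the finite sum E[G] produces a score in each term, and dividing by E[G]
  turns the coefficients into the EM weights. The representation of \<open>f\<close> is given on the
  open box, which is enough for the derivative at \<theta>.\<close>

lemma GDERIV_em_applicable_binomial:
  assumes \<theta>: "\<theta> \<in> box 0 1"
    and app: "em_applicable (binomial_support m) (binomial_product m) G f (cbox 0 1)"
  shows "GDERIV f \<theta> :> - (\<Sum>x\<in>binomial_support m.
    em_weight (binomial_support m) (binomial_product m) G \<theta> x *\<^sub>R binomial_score m x \<theta>)"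
proof -
  let ?S = "binomial_support m" and ?p = "binomial_product m"
  have G: "\<And>x. x \<in> ?S \<Longrightarrow> G x > 0" and f: "\<And>\<eta>. \<eta> \<in> box 0 1 \<Longrightarrow> f \<eta> = - ln (expect ?S ?p \<eta> G)"
    using app by (auto simp: em_applicable_def)
  have "GDERIV (\<lambda>\<eta>. ?p x \<eta> * G x) \<theta> :> G x *\<^sub>R (?p x \<theta> *\<^sub>R binomial_score m x \<theta>)"
    if "x \<in> ?S" for x
    using GDERIV_mult[OF GDERIV_binomial_product[OF \<theta> that] GDERIV_const] by simp
  then have "GDERIV (\<lambda>\<eta>. expect ?S ?p \<eta> G) \<theta>
      :> (\<Sum>x\<in>?S. G x *\<^sub>R (?p x \<theta> *\<^sub>R binomial_score m x \<theta>))"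
    unfolding expect_def real_scaleR_def by (rule GDERIV_sum)
  moreover have "DERIV ln (expect ?S ?p \<theta> G) :> inverse (expect ?S ?p \<theta> G)"
    by (intro DERIV_ln expect_binomial_product_pos \<theta> G)
  ultimately have "GDERIV (\<lambda>\<eta>. - ln (expect ?S ?p \<eta> G)) \<theta>
      :> - (inverse (expect ?S ?p \<theta> G) *\<^sub>R (\<Sum>x\<in>?S. G x *\<^sub>R (?p x \<theta> *\<^sub>R binomial_score m x \<theta>)))"
    by (intro GDERIV_minus GDERIV_DERIV_compose)
  also have "inverse (expect ?S ?p \<theta> G) *\<^sub>R (\<Sum>x\<in>?S. G x *\<^sub>R (?p x \<theta> *\<^sub>R binomial_score m x \<theta>))
      = (\<Sum>x\<in>?S. em_weight ?S ?p G \<theta> x *\<^sub>R binomial_score m x \<theta>)"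
    by (simp add: scaleR_sum_right em_weight_def divide_inverse mult_ac)
  finally show ?thesis
    by (rule GDERIV_transform_within_open[of _ _ _ "box 0 1"]) (use \<theta> f in auto)
qed

lemma em_step_binomial:
  assumes \<theta>: "\<theta> \<in> box 0 1" and m: "\<And>j. m j > 0"
    and app: "em_applicable (binomial_support m) (binomial_product m) G f (cbox 0 1)"
    and min: "is_arg_min (em_objective (binomial_support m) (binomial_product m) G \<theta>)
      (\<lambda>\<eta>. \<eta> \<in> cbox 0 1) \<eta>"
  shows "\<eta> = natural_gradient_update (binomial_support m) (binomial_product m) f \<theta>"
  unfolding vec_eq_iff
proof
  fix j
  let ?S = "binomial_support m" and ?p = "binomial_product m"
  let ?w = "em_weight ?S ?p G \<theta>"
  have G: "\<And>x. x \<in> ?S \<Longrightarrow> G x > 0"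
    using app by (auto simp: em_applicable_def)
  have \<theta>j: "\<theta> $ j \<noteq> 0" "1 - \<theta> $ j \<noteq> 0"
    using \<theta> by (auto simp: mem_box_cart less_le)
  have "\<theta> $ j * (1 - \<theta> $ j) * grad f \<theta> $ j
      = - (\<Sum>x\<in>?S. ?w x * (real (x j) - real (m j) * \<theta> $ j))"
    using \<theta>j by (simp add: grad_eqI[OF GDERIV_em_applicable_binomial[OF \<theta> app]]
        binomial_score_def sum_distrib_left)
  also have "\<dots> = (\<Sum>x\<in>?S. ?w x) * (real (m j) * \<theta> $ j) - (\<Sum>x\<in>?S. ?w x * real (x j))"
    by (simp add: right_diff_distrib sum_subtractf sum_distrib_right)
  also have "(\<Sum>x\<in>?S. ?w x) = 1"
    using expect_binomial_product_pos[OF \<theta> G] by (intro sum_em_weight) (auto simp: less_le)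
  \<comment> \<open>Thus m times the step is E_w[x] - m \<theta>: the old parameter cancels and the
    weighted mean count over m remains, as in the closed form of the minimizer.\<close>
  finally have "\<theta> $ j - \<theta> $ j * (1 - \<theta> $ j) / real (m j) * grad f \<theta> $ j
      = (\<Sum>x\<in>?S. ?w x * real (x j)) / real (m j)"
    using m[of j] by (simp add: diff_divide_distrib)
  then show "\<eta> $ j = natural_gradient_update ?S ?p f \<theta> $ j"
    by (simp only: natural_gradient_update_binomial_product[where m = m, OF \<theta> m]
        em_minimizer_binomial_eq[where m = m, OF \<theta> m G min])
qed

text \<open>The analysis of one EM step starts from an interior point. The initial point is
  interior, and each minimizer is interior again.\<close>

lemma em_iterates_binomial_interior:
  assumes "\<And>j. m j > 0" "\<And>x. x \<in> binomial_support m \<Longrightarrow> G x > 0"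
    and "em_iterates (binomial_support m) (binomial_product m) G (cbox 0 1) \<theta>"
  shows "\<theta> t \<in> box 0 1"
proof (induction t)
  case 0
  then show ?case using assms(3) by (simp add: em_iterates_def)
next
  case (Suc t)
  have min: "is_arg_min (em_objective (binomial_support m) (binomial_product m) G (\<theta> t))
      (\<lambda>\<eta>. \<eta> \<in> cbox 0 1) (\<theta> (Suc t))"
    using assms(3) unfolding em_iterates_def by (metis diff_Suc_1 le_add1 plus_1_eq_Suc)
  show ?case
    by (rule em_minimizer_binomial_interior[OF Suc _ _ min]) (auto intro: assms)
qed

section \<open>Application to the polynomial objective\<close>

theorem corollary4p5:
  fixes N :: nat and a :: "nat \<Rightarrow> real" and n :: "nat \<Rightarrow> 'p::finite \<Rightarrow> nat"
    and l u :: "real ^ 'p" and K :: real and m :: "'p \<Rightarrow> nat"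
  defines "F \<equiv> poly_fun N a n"
  defines "f \<equiv> log_objective F K l u"
  defines "S \<equiv> binomial_support m"
  defines "p \<equiv> binomial_product m"
  assumes "\<And>j. l $ j < u $ j"
    and "K > (SUP y\<in>cbox l u. F y)"
    and "\<And>j. m j > 0"
    and "\<And>i j. i \<in> {1..N} \<Longrightarrow> m j \<ge> n i j"
  shows
    "(\<forall>\<theta>\<in>interior (cbox 0 1). invertible (fisher_information S p \<theta>) \<and>
        (\<forall>\<theta>'. \<theta>' = natural_gradient_update S p f \<theta> \<longrightarrow>
           (\<forall>j. \<theta>' $ j = \<theta> $ j - \<theta> $ j * (1 - \<theta> $ j) / real (m j) * partial_deriv j f \<theta>))) \<and>
     (\<forall>G \<theta>. em_applicable S p G f (cbox 0 1) \<and> em_iterates S p G (cbox 0 1) \<theta> \<longrightarrow>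
        (\<forall>t\<ge>1. \<theta> (t - 1) \<in> interior (cbox 0 1) \<and>
           \<theta> t = natural_gradient_update S p f (\<theta> (t - 1)) \<and>
           (\<forall>j. \<theta> t $ j = \<theta> (t - 1) $ j
              - \<theta> (t - 1) $ j * (1 - \<theta> (t - 1) $ j) / real (m j)
                * partial_deriv j f (\<theta> (t - 1)))))"
  unfolding interior_cbox
proof (rule conjI)
  \<comment> \<open>\<open>partial_deriv\<close> is built on \<open>deriv\<close>, so its agreement
    with the gradient component rests on differentiability of \<open>f\<close>, which the bound
    \<open>K\<close> on the image box guarantees.\<close>
  have partial: "partial_deriv j f \<theta> = grad f \<theta> $ j" if "\<theta> \<in> box 0 1" for \<theta> j
  proof -
    have "continuous_on (cbox l u) F"
      using poly_fun_differentiable unfolding F_def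
      by (intro continuous_at_imp_continuous_on ballI differentiable_imp_continuous_within)
    moreover have "diag_matrix (u - l) *v \<theta> + l \<in> cbox l u"
      using assms(5) that box_subset_cbox by (intro affine_unit_cbox) (auto simp: less_imp_le)
    ultimately have "F (diag_matrix (u - l) *v \<theta> + l) < K"
      using assms(6) cbox_less_of_SUP_less by blast
    then have "f differentiable (at \<theta>)"
      unfolding f_def F_def by (intro log_objective_differentiable poly_fun_differentiable)
    then obtain D where "GDERIV f \<theta> :> D"
      by (rule differentiable_imp_GDERIV)
    then show ?thesis
      by (simp add: grad_eqI partial_deriv_eq_GDERIV)
  qed
  have update: "natural_gradient_update S p f \<theta> $ j
      = \<theta> $ j - \<theta> $ j * (1 - \<theta> $ j) / real (m j) * partial_deriv j f \<theta>"
    if "\<theta> \<in> box 0 1" for \<theta> j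
    unfolding partial[OF that] S_def p_def
    by (rule natural_gradient_update_binomial_product[where m = m, OF that assms(7)])
  show "\<forall>\<theta>\<in>box 0 1. invertible (fisher_information S p \<theta>) \<and>
      (\<forall>\<theta>'. \<theta>' = natural_gradient_update S p f \<theta> \<longrightarrow>
         (\<forall>j. \<theta>' $ j = \<theta> $ j - \<theta> $ j * (1 - \<theta> $ j) / real (m j) * partial_deriv j f \<theta>))"
    using update invertible_fisher_information_binomial_product[where m = m, OF _ assms(7)]
    by (auto simp: S_def p_def)
  show "\<forall>G \<theta>. em_applicable S p G f (cbox 0 1) \<and> em_iterates S p G (cbox 0 1) \<theta> \<longrightarrow>
      (\<forall>t\<ge>1. \<theta> (t - 1) \<in> box 0 1 \<and>
         \<theta> t = natural_gradient_update S p f (\<theta> (t - 1)) \<and>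
         (\<forall>j. \<theta> t $ j = \<theta> (t - 1) $ j
            - \<theta> (t - 1) $ j * (1 - \<theta> (t - 1) $ j) / real (m j)
              * partial_deriv j f (\<theta> (t - 1))))"
  proof (intro allI impI, elim conjE)
    fix G \<theta> and t :: nat
    assume app: "em_applicable S p G f (cbox 0 1)" and it: "em_iterates S p G (cbox 0 1) \<theta>"
      and t: "1 \<le> t"
    have int: "\<theta> (t - 1) \<in> box 0 1"
      using app unfolding S_def em_applicable_def
      by (intro em_iterates_binomial_interior[OF _ _ it[unfolded S_def p_def]] assms(7)) auto
    have step: "\<theta> t = natural_gradient_update S p f (\<theta> (t - 1))"
      using it t unfolding S_def p_def em_iterates_def
      by (intro em_step_binomial[where m = m, OF int assms(7) app[unfolded S_def p_def]]) auto
    show "\<theta> (t - 1) \<in> box 0 1 \<and>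
        \<theta> t = natural_gradient_update S p f (\<theta> (t - 1)) \<and>
        (\<forall>j. \<theta> t $ j = \<theta> (t - 1) $ j
           - \<theta> (t - 1) $ j * (1 - \<theta> (t - 1) $ j) / real (m j)
             * partial_deriv j f (\<theta> (t - 1)))"
      by (intro conjI allI int step) (simp only: step update[OF int])
  qed
qed

end
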